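(* Let $N$ be a finite index set, let $S,T,U \subseteq N$ and consider a rational polyhedron $P \subseteq \mathbb{R}^{N \setminus U} \times [0,1]^U$. If $x_T$ is implied integer by $x_S$ for $P$, then $x_T$ is implied integer by $x_{S'}$ for $P$ for every $S'$ with $S \subseteq S' \subseteq S \cup T \cup U$.
   Context: For $S \subseteq N$, $\mathcal{M}^S \coloneqq \{ x \in \mathbb{R}^N \mid x_i \in \mathbb{Z} \ \forall i \in S \}$. For $S,T\subseteq N$, $x_T$ is implied integer by $x_S$ for $P$ if $\mathrm{conv}(P \cap \mathcal{M}^S) = \mathrm{conv}(P \cap \mathcal{M}^{S \cup T})$. *)

theory Defs
  imports "HOL-Analysis.Analysis"
begin

text \<open>
  The index set \<open>N\<close> is the universe of a finite type \<open>'n\<close>, so that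
  \<open>\<real>\<close> to the \<open>N\<close> is \<open>real^'n\<close> and subsets of \<open>N\<close> are sets of type \<open>'n set\<close>.
\<close>

definition mixed_integer_set :: "'n::finite set \<Rightarrow> (real^'n) set" where
  "mixed_integer_set S = {x. \<forall>i\<in>S. x $ i \<in> \<int>}"

definition implied_integer :: "(real^'n::finite) set \<Rightarrow> 'n set \<Rightarrow> 'n set \<Rightarrow> bool" where
  \<comment> \<open>\<open>implied_integer P S T\<close>: \<open>x\<^sub>T\<close> is implied integer by \<open>x\<^sub>S\<close> for \<open>P\<close>\<close>
  "implied_integer P S T \<longleftrightarrow>
     convex hull (P \<inter> mixed_integer_set S) = convex hull (P \<inter> mixed_integer_set (S \<union> T))"

text \<open>
  Solution set of a finite system \<open>A x \<le> b\<close> with rational data; a pair \<open>(a, \<beta>)\<close> is a row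
  of the system. Zero rows are permitted, unlike in the library's \<open>polyhedron\<close>.
\<close>

definition rational_polyhedron :: "(real^'n::finite) set \<Rightarrow> bool" where
  "rational_polyhedron P \<longleftrightarrow>
     (\<exists>C :: ((real^'n) \<times> real) set. finite C
        \<and> (\<forall>(a, \<beta>)\<in>C. (\<forall>i. a $ i \<in> \<rat>) \<and> \<beta> \<in> \<rat>)
        \<and> P = {x. \<forall>(a, \<beta>)\<in>C. a \<bullet> x \<le> \<beta>})"

end

theory Submission
  imports Defs
begin

text \<open>
  Write a point \<open>x\<close> of \<open>P\<close> that is integral on \<open>S'\<close> as a convex combination, with positive weights,
  of points of \<open>P\<close> that are integral on \<open>S \<union> T\<close>. For \<open>i \<in> S' \<inter> U\<close> the value \<open>x\<^sub>i\<close> is an end point of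
  \<open>[0,1]\<close>, an interval that contains the \<open>i\<close>-th coordinates of all these points, so they all have
  \<open>i\<close>-th coordinate \<open>x\<^sub>i\<close>.
\<close>

text \<open>Slack is affine: in a convex combination giving \<open>x\<close>, the slack of
  \<open>x\<close> in a row of \<open>C\<close> is the weighted average of the slacks of the points.
  The average is zero and the terms are nonnegative, so each point of positive weight has slack
  zero. One combination serves all rows at once.\<close>

lemma convex_hull_active_constraints:
  fixes Q :: "'a::real_inner set" and C :: "('a \<times> real) set"
  assumes x: "x \<in> convex hull Q"
    and valid: "\<And>a \<beta> y. (a, \<beta>) \<in> C \<Longrightarrow> y \<in> Q \<Longrightarrow> a \<bullet> y \<le> \<beta>"
    and active: "\<And>a \<beta>. (a, \<beta>) \<in> C \<Longrightarrow> a \<bullet> x = \<beta>"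
  shows "x \<in> convex hull {y \<in> Q. \<forall>(a, \<beta>)\<in>C. a \<bullet> y = \<beta>}"
proof -
  obtain F u where F: "finite F" "F \<subseteq> Q" and u: "\<And>y. y \<in> F \<Longrightarrow> 0 \<le> u y" "sum u F = 1"
    and xeq: "(\<Sum>y\<in>F. u y *\<^sub>R y) = x"
    using x unfolding convex_hull_explicit by auto
  \<comment> \<open>A vanishing weighted slack forces a vanishing slack only where the weight is
    nonzero, so points of weight zero are dropped first.\<close>
  define G where "G = {y \<in> F. u y \<noteq> 0}"
  have G: "finite G" "G \<subseteq> F"
    using F by (auto simp: G_def)
  have sum_G: "sum u G = 1" "(\<Sum>y\<in>G. u y *\<^sub>R y) = x"
    unfolding u(2)[symmetric] xeq[symmetric]
    by (rule sum.mono_neutral_left; use F in \<open>auto simp: G_def\<close>)+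
  have "a \<bullet> y = \<beta>" if "y \<in> G" "(a, \<beta>) \<in> C" for y a \<beta>
  proof -
    have nonneg: "0 \<le> u z * (\<beta> - a \<bullet> z)" if "z \<in> G" for z
      using valid[OF \<open>(a, \<beta>) \<in> C\<close>, of z] u(1)[of z] that G F
      by (intro mult_nonneg_nonneg) auto
    have "(\<Sum>z\<in>G. u z * (\<beta> - a \<bullet> z)) = sum u G * \<beta> - a \<bullet> (\<Sum>z\<in>G. u z *\<^sub>R z)"
      by (simp add: right_diff_distrib sum_subtractf sum_distrib_right inner_sum_right)
    also have "\<dots> = 0"
      using sum_G active[OF that(2)] by simp
    finally have "u y * (\<beta> - a \<bullet> y) = 0"
      using sum_nonneg_eq_0_iff[of G "\<lambda>z. u z * (\<beta> - a \<bullet> z)"] nonneg G that(1) by auto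
    then show ?thesis
      using that(1) by (auto simp: G_def)
  qed
  then have "G \<subseteq> {y \<in> Q. \<forall>(a, \<beta>)\<in>C. a \<bullet> y = \<beta>}"
    using F G by auto
  moreover have "x \<in> convex hull G"
    using G sum_G u(1) unfolding convex_hull_explicit by blast
  ultimately show ?thesis
    using hull_mono by blast
qed

lemma convex_hull_unit_interval_coordinates:
  fixes Q :: "(real^'n) set"
  assumes x: "x \<in> convex hull Q"
    and Q: "\<And>y i. y \<in> Q \<Longrightarrow> i \<in> I \<Longrightarrow> y $ i \<in> {0..1}"
    and xI: "\<And>i. i \<in> I \<Longrightarrow> x $ i \<in> {0, 1}"
  shows "x \<in> convex hull {y \<in> Q. \<forall>i\<in>I. y $ i = x $ i}"
proof -
  \<comment> \<open>The sign \<open>s i\<close> is 1 if \<open>x $ i = 1\<close> and -1 if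
    \<open>x $ i = 0\<close>. The row of \<open>i\<close> in \<open>C\<close> thus reads
    \<open>y $ i \<le> 1\<close> or \<open>- y $ i \<le> 0\<close>: the bound of the unit interval
    that is tight at \<open>x\<close>.\<close>
  define s :: "'n \<Rightarrow> real" where "s i = 2 * x $ i - 1" for i
  define C where "C = (\<lambda>i. (axis i (s i), s i * x $ i)) ` I"
  have "x \<in> convex hull {y \<in> Q. \<forall>(a, \<beta>)\<in>C. a \<bullet> y = \<beta>}"
  proof (rule convex_hull_active_constraints[OF x])
    show "a \<bullet> y \<le> \<beta>" if C: "(a, \<beta>) \<in> C" and y: "y \<in> Q" for a \<beta> y
    proof -
      obtain i where i: "i \<in> I" "a = axis i (s i)" "\<beta> = s i * x $ i"
        using C by (auto simp: C_def)
      then show ?thesis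
        using Q[OF y i(1)] xI[OF i(1)] by (auto simp: s_def inner_axis')
    qed
    show "a \<bullet> x = \<beta>" if "(a, \<beta>) \<in> C" for a \<beta>
      using that by (auto simp: C_def inner_axis')
  qed
  \<comment> \<open>This allows cancelling \<open>s i\<close> in
    \<open>s i * y $ i = s i * x $ i\<close>.\<close>
  moreover have "s i \<noteq> 0" if "i \<in> I" for i
    using xI[OF that] by (auto simp: s_def)
  ultimately show ?thesis
    by (simp add: C_def inner_axis')
qed

theorem theorem8:
  fixes S T U :: "'n::finite set"
    and P :: "(real^'n) set"
  assumes "rational_polyhedron P"
    and "P \<subseteq> {x. \<forall>i\<in>U. x $ i \<in> {0..1}}"
    and "implied_integer P S T"
  shows "\<forall>S'. S \<subseteq> S' \<and> S' \<subseteq> S \<union> T \<union> U \<longrightarrow> implied_integer P S' T"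
proof (intro allI impI)
  fix S' assume S': "S \<subseteq> S' \<and> S' \<subseteq> S \<union> T \<union> U"
  \<comment> \<open>As the target hull is convex, the nontrivial inclusion need only be checked at
    the generators \<open>x\<close>.\<close>
  have "x \<in> convex hull (P \<inter> mixed_integer_set (S' \<union> T))"
    if x: "x \<in> P \<inter> mixed_integer_set S'" for x
  proof -
    let ?Q = "P \<inter> mixed_integer_set (S \<union> T)" and ?I = "S' \<inter> U"
    have xI: "x $ i \<in> {0, 1}" if "i \<in> ?I" for i
    proof -
      have "x $ i \<in> \<int>" "0 \<le> x $ i" "x $ i \<le> 1"
        using that x assms(2) by (auto simp: mixed_integer_set_def)
      then obtain k :: int where "x $ i = of_int k" "0 \<le> k" "k \<le> 1"
        by (metis Ints_cases of_int_0_le_iff of_int_le_1_iff)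
      then show ?thesis
        by (cases "k = 0") auto
    qed
    have "x \<in> P \<inter> mixed_integer_set S"
      using x S' by (auto simp: mixed_integer_set_def)
    then have "x \<in> convex hull (P \<inter> mixed_integer_set S)"
      by (rule hull_inc)
    then have "x \<in> convex hull ?Q"
      using assms(3) by (simp only: implied_integer_def)
    then have "x \<in> convex hull {y \<in> ?Q. \<forall>i\<in>?I. y $ i = x $ i}"
      by (rule convex_hull_unit_interval_coordinates) (use assms(2) xI in auto)
    moreover have "{y \<in> ?Q. \<forall>i\<in>?I. y $ i = x $ i} \<subseteq> P \<inter> mixed_integer_set (S' \<union> T)"
    proof
      fix y assume y: "y \<in> {y \<in> ?Q. \<forall>i\<in>?I. y $ i = x $ i}"
      \<comment> \<open>An index outside \<open>S \<union> T\<close> lies in both \<open>S'\<close>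
        and \<open>U\<close>; there \<open>y\<close> agrees with \<open>x\<close>, which is integral
        on \<open>S'\<close>.\<close>
      have "y $ i \<in> \<int>" if "i \<in> S' \<union> T" for i
      proof (cases "i \<in> S \<union> T")
        case True
        then show ?thesis
          using y by (auto simp: mixed_integer_set_def)
      next
        case False
        then have "i \<in> ?I"
          using that S' by blast
        then show ?thesis
          using y x by (auto simp: mixed_integer_set_def)
      qed
      then show "y \<in> P \<inter> mixed_integer_set (S' \<union> T)"
        using y by (auto simp: mixed_integer_set_def)
    qed
    ultimately show ?thesis
      using hull_mono by blast
  qed
  then have "convex hull (P \<inter> mixed_integer_set S')
      \<subseteq> convex hull (P \<inter> mixed_integer_set (S' \<union> T))"
    by (intro hull_minimal) (auto simp: convex_convex_hull)
  moreover have "convex hull (P \<inter> mixed_integer_set (S' \<union> T))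
      \<subseteq> convex hull (P \<inter> mixed_integer_set S')"
    by (rule hull_mono) (auto simp: mixed_integer_set_def)
  ultimately show "implied_integer P S' T"
    unfolding implied_integer_def by blast
qed

end
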